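(* Let $\mathcal{C}_1$ and $\mathcal{C}_2$ be two convex subsets of $\mathbb{R}^m$, and let $g,h:\mathbb{R}^m\to\mathbb{R}^m$ be Lipschitz continuous functions such that $g$ maps $\mathcal{C}_1$ into $\mathcal{C}_2$ and $h$ maps $\mathcal{C}_2$ into $\mathcal{C}_1$. Assume that $h\circ g:\mathcal{C}_1\to\mathcal{C}_1$ and $g\circ h:\mathcal{C}_2\to\mathcal{C}_2$ are sup-mean contractive (on $\mathcal{C}_1$ and $\mathcal{C}_2$, respectively). For $k\ge0$ define the time-varying map $f_k$ by $f_{2k}=g$ and $f_{2k+1}=h$. Then the orbit of $z_{k+1}=f_k(z_k)$ with initial value $z_0\in\mathcal{C}_1$ converges either to a limit cycle of period $2$ or to a fixed point.
   Context: A time-invariant map $\phi$ leaving a set $\mathcal{C}$ invariant is sup-mean contractive on $\mathcal{C}$ if there is a norm $\|\cdot\|$ on $\mathbb{R}^m$ with $r_{\|\cdot\|}[\phi]=L_{\|\cdot\|}[\phi]-1<0$, where $L_{\|\cdot\|}[\phi]=\sup_{x\neq y,\ x,y\in\mathcal{C}}\frac{\|\phi(x)-\phi(y)\|}{\|x-y\|}$ (a supremum over the empty set being $0$). A fixed point of $z_{k+1}=f_k(z_k)$ is a point $x^*$ with $g(x^* )=x^*=h(x^* )$. A limit cycle of period $2$ is a pair of distinct points $x^*\ne y^*$ with $g(x^* )=y^*$ and $h(y^* )=x^*$; the orbit $\{z_k\}$ converges to it if $z_{2k}\to x^*$ and $z_{2k+1}\to y^*$ as $k\to\infty$. *)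

theory Defs
  imports "HOL-Analysis.Analysis"
begin

text \<open>
  An arbitrary norm on a real vector space, as a predicate: the type-class norm on
  \<open>real ^ 'm\<close> is only the Euclidean one.
\<close>

definition is_norm :: "('a::real_vector \<Rightarrow> real) \<Rightarrow> bool" where
  "is_norm N \<longleftrightarrow>
     (\<forall>x. 0 \<le> N x) \<and>
     (\<forall>x. N x = 0 \<longleftrightarrow> x = 0) \<and>
     (\<forall>c x. N (c *\<^sub>R x) = \<bar>c\<bar> * N x) \<and>
     (\<forall>x y. N (x + y) \<le> N x + N y)"

text \<open>
  The supremum is taken in the extended reals, so it is \<open>\<infinity>\<close> for an unbounded set of quotients.
  Inserting 0 makes the supremum over the empty set 0; for a norm all quotients are
  nonnegative, so it changes nothing otherwise.
\<close>

definition lip_const :: "('a::real_vector \<Rightarrow> real) \<Rightarrow> 'a set \<Rightarrow> ('a \<Rightarrow> 'a) \<Rightarrow> ereal" where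
  "lip_const N C \<phi> =
     Sup (insert 0 {ereal (N (\<phi> x - \<phi> y) / N (x - y)) | x y. x \<in> C \<and> y \<in> C \<and> x \<noteq> y})"

definition sup_mean_rate :: "('a::real_vector \<Rightarrow> real) \<Rightarrow> 'a set \<Rightarrow> ('a \<Rightarrow> 'a) \<Rightarrow> ereal" where
  "sup_mean_rate N C \<phi> = lip_const N C \<phi> - 1"

definition sup_mean_contractive_on :: "'a::real_vector set \<Rightarrow> ('a \<Rightarrow> 'a) \<Rightarrow> bool" where
  "sup_mean_contractive_on C \<phi> \<longleftrightarrow>
     \<phi> ` C \<subseteq> C \<and> (\<exists>N. is_norm N \<and> sup_mean_rate N C \<phi> < 0)"

definition is_fixed_point :: "('a \<Rightarrow> 'a) \<Rightarrow> ('a \<Rightarrow> 'a) \<Rightarrow> 'a \<Rightarrow> bool" where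
  "is_fixed_point g h x \<longleftrightarrow> g x = x \<and> h x = x"

definition is_limit_cycle2 :: "('a \<Rightarrow> 'a) \<Rightarrow> ('a \<Rightarrow> 'a) \<Rightarrow> 'a \<Rightarrow> 'a \<Rightarrow> bool" where
  "is_limit_cycle2 g h x y \<longleftrightarrow> x \<noteq> y \<and> g x = y \<and> h y = x"

definition converges_to_cycle2 :: "(nat \<Rightarrow> 'a::topological_space) \<Rightarrow> 'a \<Rightarrow> 'a \<Rightarrow> bool" where
  "converges_to_cycle2 z x y \<longleftrightarrow>
     (\<lambda>k. z (2 * k)) \<longlonglongrightarrow> x \<and> (\<lambda>k. z (2 * k + 1)) \<longlonglongrightarrow> y"

end

theory Submission
  imports Defs "HOL-Probability.Characteristic_Functions"
begin

text \<open>
  Iterating the contraction \<open>h \<circ> g\<close> from \<open>z 0\<close> gives the even-indexed points, which therefore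
  converge to some \<open>x\<close>: the contraction is with respect to an arbitrary norm, but all norms on a
  Euclidean space are equivalent. The sets need not be closed, so \<open>x\<close> may lie outside \<open>C1\<close>; the
  continuity of \<open>g\<close> and \<open>h\<close> on the whole space still gives \<open>h (g x) = x\<close>, and the odd-indexed
  points converge to \<open>g x\<close>.
\<close>

lemma is_norm_zero: "is_norm N \<Longrightarrow> N 0 = 0"
  by (simp add: is_norm_def)

lemma is_norm_sum_le:
  assumes "is_norm N"
  shows "N (\<Sum>i\<in>A. v i) \<le> (\<Sum>i\<in>A. N (v i))"
proof (induction A rule: infinite_finite_induct)
  case (insert i A)
  have "N (v i + (\<Sum>i\<in>A. v i)) \<le> N (v i) + N (\<Sum>i\<in>A. v i)"
    using assms unfolding is_norm_def by blast
  then show ?case using insert by simp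
qed (simp_all add: is_norm_zero[OF assms])

text \<open>Expanding \<open>x\<close> in the standard basis bounds \<open>N x\<close> by the
  coordinates of \<open>x\<close>, each at most \<open>norm x\<close> in absolute value; this gives
  \<open>B\<close> as the sum of \<open>N b\<close> over \<open>Basis\<close>.\<close>

lemma is_norm_le_norm:
  fixes N :: "'a::euclidean_space \<Rightarrow> real"
  assumes "is_norm N"
  obtains B where "\<And>x. N x \<le> B * norm x"
proof
  fix x :: 'a
  have "N x = N (\<Sum>b\<in>Basis. (x \<bullet> b) *\<^sub>R b)"
    by (simp add: euclidean_representation)
  also have "\<dots> \<le> (\<Sum>b\<in>Basis. N ((x \<bullet> b) *\<^sub>R b))"
    by (rule is_norm_sum_le[OF assms])
  also have "\<dots> = (\<Sum>b\<in>Basis. N b * \<bar>x \<bullet> b\<bar>)"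
    using assms by (simp add: is_norm_def mult.commute)
  also have "\<dots> \<le> (\<Sum>b\<in>Basis. N b * norm x)"
    using assms by (intro sum_mono mult_left_mono) (auto simp: is_norm_def Basis_le_norm)
  finally show "N x \<le> (\<Sum>b\<in>Basis. N b) * norm x"
    by (simp add: sum_distrib_right)
qed

text \<open>The reverse triangle inequality combined with the bound by the Euclidean norm makes
  \<open>N\<close> Lipschitz.\<close>

lemma is_norm_continuous_on:
  fixes N :: "'a::euclidean_space \<Rightarrow> real"
  assumes "is_norm N"
  shows "continuous_on S N"
proof -
  obtain B where B: "\<And>x. N x \<le> B * norm x"
    using is_norm_le_norm[OF assms] by blast
  \<comment> \<open>A Lipschitz constant has to be nonnegative, and the sign of \<open>B\<close> is
    not recorded, hence the absolute value.\<close>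
  have B': "N x \<le> \<bar>B\<bar> * norm x" for x
    using B[of x] by (smt (verit) mult_right_mono norm_ge_zero)
  have diff: "N x - N y \<le> \<bar>B\<bar> * norm (x - y)" for x y
  proof -
    have "N ((x - y) + y) \<le> N (x - y) + N y"
      using assms unfolding is_norm_def by blast
    then show ?thesis using B'[of "x - y"] by simp
  qed
  have "\<bar>B\<bar>-lipschitz_on S N"
  proof (rule lipschitz_onI)
    show "dist (N x) (N y) \<le> \<bar>B\<bar> * dist x y" for x y
      using diff[of x y] diff[of y x] by (auto simp: dist_norm norm_minus_commute abs_if)
  qed simp
  then show ?thesis by (rule lipschitz_on_continuous_on)
qed

text \<open>The continuous function \<open>N\<close> attains its minimum on the compact unit sphere,
  and that minimum is positive. By homogeneity its reciprocal serves as \<open>A\<close>.\<close>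

lemma norm_le_is_norm:
  fixes N :: "'a::euclidean_space \<Rightarrow> real"
  assumes "is_norm N"
  obtains A where "0 < A" "\<And>x. norm x \<le> A * N x"
proof -
  obtain u :: 'a where u: "norm u = 1" and min: "\<And>v :: 'a. norm v = 1 \<Longrightarrow> N u \<le> N v"
    using continuous_attains_inf[OF _ _ is_norm_continuous_on[OF assms], of "sphere 0 1"]
    by auto
  have pos: "0 < N u"
    using assms u unfolding is_norm_def by (metis norm_zero order_le_less zero_neq_one)
  have "norm x \<le> 1 / N u * N x" for x
  proof (cases "x = 0")
    case True
    then show ?thesis by (simp add: is_norm_zero[OF assms])
  next
    case False
    have "N u \<le> N (inverse (norm x) *\<^sub>R x)"
      by (rule min) (simp add: False)
    also have "\<dots> = N x / norm x"
      using assms by (simp add: is_norm_def divide_inverse mult.commute)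
    finally show ?thesis
      using False pos by (simp add: field_simps)
  qed
  with pos that[of "1 / N u"] show ?thesis by simp
qed

text \<open>Replaces the extended-real supremum by a real contraction factor, in the form used for
  iteration.\<close>

lemma sup_mean_contractive_onE:
  assumes "sup_mean_contractive_on C \<phi>"
  obtains N c where "is_norm N" "0 \<le> c" "c < 1"
    "\<And>x y. x \<in> C \<Longrightarrow> y \<in> C \<Longrightarrow> N (\<phi> x - \<phi> y) \<le> c * N (x - y)"
proof -
  obtain N where N: "is_norm N" and "sup_mean_rate N C \<phi> < 0"
    using assms unfolding sup_mean_contractive_on_def by blast
  then have less: "lip_const N C \<phi> < 1"
    unfolding sup_mean_rate_def by (cases "lip_const N C \<phi>") (auto simp: one_ereal_def)
  have ge: "0 \<le> lip_const N C \<phi>"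
    unfolding lip_const_def by (rule Sup_upper) simp
  \<comment> \<open>The bounds 0 and 1 exclude both infinite values.\<close>
  obtain c where c: "lip_const N C \<phi> = ereal c"
    using less ge by (cases "lip_const N C \<phi>") auto
  have "N (\<phi> x - \<phi> y) \<le> c * N (x - y)" if "x \<in> C" "y \<in> C" for x y
  proof (cases "x = y")
    case True
    then show ?thesis by (simp add: is_norm_zero[OF N])
  next
    case False
    have "ereal (N (\<phi> x - \<phi> y) / N (x - y)) \<le> lip_const N C \<phi>"
      unfolding lip_const_def using that False by (intro Sup_upper) blast
    moreover have "0 < N (x - y)"
      using N False unfolding is_norm_def by (metis order_le_less right_minus_eq)
    ultimately show ?thesis using c by (simp add: field_simps)
  qed
  with N c less ge that show ?thesis by simp
qed

text \<open>The existence half of Banach's fixed point argument. Completeness is that of the whole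
  space, so the limit is not claimed to lie in \<open>C\<close>.\<close>

lemma sup_mean_contractive_on_orbit_convergent:
  fixes u :: "nat \<Rightarrow> 'a::euclidean_space"
  assumes contr: "sup_mean_contractive_on C \<phi>"
    and u0: "u 0 \<in> C" and step: "\<And>k. u (Suc k) = \<phi> (u k)"
  shows "convergent u"
proof -
  obtain N c where N: "is_norm N" and c: "0 \<le> c" "c < 1"
    and lip: "\<And>x y. x \<in> C \<Longrightarrow> y \<in> C \<Longrightarrow> N (\<phi> x - \<phi> y) \<le> c * N (x - y)"
    using sup_mean_contractive_onE[OF contr] by metis
  obtain A where A: "0 < A" "\<And>x. norm x \<le> A * N x"
    using norm_le_is_norm[OF N] by blast
  have uC: "u k \<in> C" for k
    using contr by (induction k) (auto simp: u0 step sup_mean_contractive_on_def)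
  have geo: "N (u (Suc k) - u k) \<le> c ^ k * N (u 1 - u 0)" for k
  proof (induction k)
    case (Suc k)
    have "N (u (Suc (Suc k)) - u (Suc k)) \<le> c * N (u (Suc k) - u k)"
      using lip[OF uC[of "Suc k"] uC[of k]] by (simp only: step)
    also have "\<dots> \<le> c * (c ^ k * N (u 1 - u 0))"
      using Suc c by (intro mult_left_mono)
    finally show ?case by (simp add: mult.assoc)
  qed simp
  \<comment> \<open>The factor \<open>A\<close> turns the geometric decay in \<open>N\<close> into
    one in the Euclidean norm; the partial sums of this series telescope to
    \<open>u n - u 0\<close>.\<close>
  have "summable (\<lambda>k. u (Suc k) - u k)"
  proof (rule summable_comparison_test')
    show "summable (\<lambda>k. A * N (u 1 - u 0) * c ^ k)"
      using c by (intro summable_mult summable_geometric) simp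
    show "norm (u (Suc k) - u k) \<le> A * N (u 1 - u 0) * c ^ k" if "0 \<le> k" for k
      using order_trans[OF A(2) mult_left_mono[OF geo]] A(1) by (simp add: mult_ac)
  qed
  then have "convergent (\<lambda>n. u n - u 0)"
    by (simp add: summable_iff_convergent sum_lessThan_telescope)
  from convergent_add[OF this convergent_const[of "u 0"]] show ?thesis by simp
qed

theorem proposition5:
  fixes C1 C2 :: "(real ^ 'm) set"
    and g h :: "real ^ 'm \<Rightarrow> real ^ 'm"
    and f :: "nat \<Rightarrow> real ^ 'm \<Rightarrow> real ^ 'm"
    and z :: "nat \<Rightarrow> real ^ 'm"
  assumes "convex C1" and "convex C2"
    and "\<exists>L. L-lipschitz_on UNIV g" and "\<exists>L. L-lipschitz_on UNIV h"
    and "g ` C1 \<subseteq> C2" and "h ` C2 \<subseteq> C1"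
    and "sup_mean_contractive_on C1 (h \<circ> g)"
    and "sup_mean_contractive_on C2 (g \<circ> h)"
    and "\<And>k. f (2 * k) = g" and "\<And>k. f (2 * k + 1) = h"
    and "z 0 \<in> C1" and "\<And>k. z (Suc k) = f k (z k)"
  shows "(\<exists>x y. is_limit_cycle2 g h x y \<and> converges_to_cycle2 z x y) \<or>
         (\<exists>x. is_fixed_point g h x \<and> z \<longlonglongrightarrow> x)"
proof -
  have gcont: "isCont g x" and hcont: "isCont h x" for x
    using assms(3,4) lipschitz_on_continuous_on[of _ UNIV]
    by (auto simp: continuous_on_eq_continuous_at)
  have odd: "z (2 * k + 1) = g (z (2 * k))" and even: "z (2 * Suc k) = h (z (2 * k + 1))" for k
    using assms(12)[of "2 * k"] assms(12)[of "2 * k + 1"] assms(9,10) by simp_all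
  have "convergent (\<lambda>k. z (2 * k))"
    using assms(11) even odd
    by (intro sup_mean_contractive_on_orbit_convergent[OF assms(7)]) simp_all
  then obtain x where x: "(\<lambda>k. z (2 * k)) \<longlonglongrightarrow> x"
    unfolding convergent_def by blast
  have y: "(\<lambda>k. z (2 * k + 1)) \<longlonglongrightarrow> g x"
    unfolding odd by (rule isCont_tendsto_compose[OF gcont x])
  have "(\<lambda>k. z (2 * Suc k)) \<longlonglongrightarrow> h (g x)"
    unfolding even by (rule isCont_tendsto_compose[OF hcont y])
  moreover have "(\<lambda>k. z (2 * Suc k)) \<longlonglongrightarrow> x"
    using LIMSEQ_Suc[OF x] .
  ultimately have hg: "h (g x) = x"
    by (rule LIMSEQ_unique)
  show ?thesis
  \<comment> \<open>If \<open>g x = x\<close>, then \<open>hg\<close> also gives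
    \<open>h x = x\<close>, and the even and odd subsequences share the limit \<open>x\<close>.
    Otherwise \<open>x\<close> and \<open>g x\<close> form a genuine cycle.\<close>
  proof (cases "g x = x")
    case True
    then have "z \<longlonglongrightarrow> x"
      using limseq_even_odd[OF x] y by simp
    with True hg show ?thesis by (auto simp: is_fixed_point_def)
  next
    case False
    then have "is_limit_cycle2 g h x (g x)" "converges_to_cycle2 z x (g x)"
      using hg x y by (auto simp: is_limit_cycle2_def converges_to_cycle2_def)
    then show ?thesis by blast
  qed
qed

end
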